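(* Let $\Sigma$ be a finite alphabet and let $d_G$ be either the Besicovitch pseudometric $d_B$ or the Weyl pseudometric $d_W$ on $\Sigma^{\mathbb{Z}}$. If $f:\Sigma^{\mathbb{Z}}\to\Sigma^{\mathbb{Z}}$ is a cellular automaton that is expanding, i.e. $d_G(x,y)\le d_G(f(x),f(y))$ for all $x,y\in\Sigma^{\mathbb{Z}}$, then $f$ is an isometry, i.e. $d_G(x,y)= d_G(f(x),f(y))$ for all $x,y\in\Sigma^{\mathbb{Z}}$.
   Context: For words $u,v$ of equal length, $H(u,v)$ is the Hamming distance. On $\Sigma^{\mathbb{Z}}$, $d_B(x,y)=\limsup_{n\to\infty}\frac{H(x_{[-n,n]},y_{[-n,n]})}{2n+1}$ and $d_W(x,y)=\limsup_{n\to\infty}\max_{m\in\mathbb{Z}}\frac{H(x_{[m-n,m+n]},y_{[m-n,m+n]})}{2n+1}$. A cellular automaton on $\Sigma^{\mathbb{Z}}$ is a map that is continuous in the product topology and commutes with the shift $\sigma(x)_i=x_{i+1}$. *)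

theory Defs
  imports "HOL-Analysis.Analysis"
begin

type_synonym 'a config = "int \<Rightarrow> 'a"

(* Meant for words of equal length only. *)
definition hamming :: "'a list \<Rightarrow> 'a list \<Rightarrow> nat" where
  "hamming u v = card {k. k < length u \<and> u ! k \<noteq> v ! k}"

definition subword :: "'a config \<Rightarrow> int \<Rightarrow> int \<Rightarrow> 'a list" where
  "subword x i j = map x [i..j]"

definition window_density :: "'a config \<Rightarrow> 'a config \<Rightarrow> int \<Rightarrow> nat \<Rightarrow> real" where
  "window_density x y m n =
     real (hamming (subword x (m - int n) (m + int n)) (subword y (m - int n) (m + int n)))
       / (2 * real n + 1)"

(* The distances take values in [0,1]; the type ereal is used because limsup is an
   operation on complete lattices. *)
definition besicovitch_dist :: "'a config \<Rightarrow> 'a config \<Rightarrow> ereal" where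
  "besicovitch_dist x y = limsup (\<lambda>n. ereal (window_density x y 0 n))"

definition weyl_dist :: "'a config \<Rightarrow> 'a config \<Rightarrow> ereal" where
  "weyl_dist x y = limsup (\<lambda>n. ereal (MAX m. window_density x y m n))"

lemma hamming_le_length: "hamming u v \<le> length u"
proof -
  have "hamming u v \<le> card {..<length u}"
    unfolding hamming_def by (rule card_mono) auto
  then show ?thesis by simp
qed

lemma length_subword: "length (subword x (m - int n) (m + int n)) = 2 * n + 1"
  by (simp add: subword_def)

(* The maximum in weyl_dist is attained: for fixed n only finitely many densities occur. *)
lemma finite_range_window_density: "finite (range (\<lambda>m. window_density x y m n))"
proof (rule finite_subset)
  show "range (\<lambda>m. window_density x y m n) \<subseteq> (\<lambda>h. real h / (2 * real n + 1)) ` {..2 * n + 1}"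
    unfolding window_density_def
    using hamming_le_length length_subword by (metis (no_types, lifting) atMost_iff image_eqI image_subsetI)
qed simp

lemma window_density_bounds: "0 \<le> window_density x y m n" "window_density x y m n \<le> 1"
proof -
  have "hamming (subword x (m - int n) (m + int n)) (subword y (m - int n) (m + int n)) \<le> 2 * n + 1"
    using hamming_le_length length_subword by metis
  then have "real (hamming (subword x (m - int n) (m + int n)) (subword y (m - int n) (m + int n)))
      \<le> 2 * real n + 1"
    by linarith
  then show "window_density x y m n \<le> 1"
    unfolding window_density_def by simp
  show "0 \<le> window_density x y m n"
    unfolding window_density_def by simp
qed

definition shift :: "'a config \<Rightarrow> 'a config" where
  "shift x = (\<lambda>i. x (i + 1))"

definition config_topology :: "'a config topology" where
  "config_topology = product_topology (\<lambda>_. discrete_topology UNIV) UNIV"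

definition cellular_automaton :: "('a config \<Rightarrow> 'a config) \<Rightarrow> bool" where
  "cellular_automaton f \<longleftrightarrow>
     continuous_map config_topology config_topology f \<and> f \<circ> shift = shift \<circ> f"

end

(* On the finite set of p-periodic configurations both pseudometrics equal the Hamming
   distance of one period divided by p. An expanding cellular automaton maps this set
   injectively, hence bijectively, to itself, so it preserves the sum of the Hamming
   distances over all pairs; since it decreases none of them, it preserves each of them.
   For arbitrary x and y, replace both by the periodic continuations of their restrictions
   to a window: with r the radius of f, the images change in at most 2r positions of that
   window, so the window densities of (x, y) and (f x, f y) differ by O(1/n) uniformly
   in the position of the window. *)
theory Submission
  imports Defs "HOL-Real_Asymp.Real_Asymp"
begin

section \<open>Mismatch counts and periodic configurations\<close>

definition mismatches :: "'a config \<Rightarrow> 'a config \<Rightarrow> int \<Rightarrow> nat \<Rightarrow> nat" where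
  "mismatches x y a p = (\<Sum>k<p. of_bool (x (a + int k) \<noteq> y (a + int k)))"

definition periodic_configs :: "nat \<Rightarrow> 'a config set" where
  "periodic_configs p = {x. \<forall>i. x (i + int p) = x i}"

text \<open>Reducing \<open>i - a\<close> rather than \<open>i\<close> puts the seam at the left end
  of the window, so that the cells from \<open>a\<close> to \<open>a + p - 1\<close> are copied
  unchanged.\<close>

definition periodize :: "int \<Rightarrow> nat \<Rightarrow> 'a config \<Rightarrow> 'a config" where
  "periodize a p x = (\<lambda>i. x (a + (i - a) mod int p))"

text \<open>Describing a window by its left end and length instead of its centre and radius allows
  windows to be cut and concatenated.\<close>

lemma window_density_mismatches:
  "window_density x y m n = mismatches x y (m - int n) (2 * n + 1) / (2 * real n + 1)"
proof -
  have "hamming (subword x (m - int n) (m + int n)) (subword y (m - int n) (m + int n))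
      = card {k. k < 2 * n + 1 \<and> x (m - int n + int k) \<noteq> y (m - int n + int k)}"
    unfolding hamming_def length_subword
    by (rule arg_cong[of _ _ card]) (auto simp: subword_def nth_upto)
  also have "\<dots> = mismatches x y (m - int n) (2 * n + 1)"
    by (simp add: mismatches_def of_bool_def sum.If_cases Int_def conj_commute lessThan_def del: sum.lessThan_Suc)
  finally show ?thesis
    by (simp add: window_density_def)
qed

lemma mismatches_le: "mismatches x y a p \<le> p"
  unfolding mismatches_def
  by (rule order_trans[OF sum_mono[where g = "\<lambda>_. 1"]]) auto

lemma mismatches_add:
  "mismatches x y a (p + q) = mismatches x y a p + mismatches x y (a + int p) q"
  by (induction q) (simp_all add: mismatches_def add.assoc)

text \<open>This serves as a two-sided induction for window positions, multiples of a period and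
  powers of the shift.\<close>

lemma int_successor_invariant_const:
  fixes g :: "int \<Rightarrow> 'b"
  assumes "\<And>i. g (i + 1) = g i"
  shows "g a = g b"
proof -
  have "g c = g 0" for c
  proof (induction c rule: int_induct[of _ 0])
    case (step2 i)
    then show ?case using assms[of "i - 1"] by simp
  qed (simp_all add: assms)
  then show ?thesis by metis
qed

lemma mismatches_periodic_shift:
  assumes "x \<in> periodic_configs p" "y \<in> periodic_configs p"
  shows "mismatches x y a p = mismatches x y b p"
proof -
  have step: "mismatches x y (c + 1) p = mismatches x y c p" for c
  proof -
    \<comment> \<open>Both sides count the window of length \<open>p + 1\<close> that starts at
      \<open>c\<close>, cut after its first cell and before its last one. These two cells lie one
      period apart, so their contributions cancel.\<close>
    have "mismatches x y c 1 + mismatches x y (c + 1) p = mismatches x y c p + mismatches x y (c + int p) 1"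
      using mismatches_add[of x y c 1 p] mismatches_add[of x y c p 1] by (simp add: add.commute)
    moreover have "mismatches x y (c + int p) 1 = mismatches x y c 1"
      using assms by (simp add: mismatches_def periodic_configs_def)
    ultimately show ?thesis by simp
  qed
  then show ?thesis
    by (rule int_successor_invariant_const)
qed

lemma mismatches_periodic_mult:
  assumes "x \<in> periodic_configs p" "y \<in> periodic_configs p"
  shows "mismatches x y a (q * p) = q * mismatches x y 0 p"
proof (induction q)
  case (Suc q)
  then show ?case
    using mismatches_add[of x y a "q * p" p] mismatches_periodic_shift[OF assms]
    by (simp add: add.commute)
qed (simp add: mismatches_def)

text \<open>The full periods inside the window contribute equally to both terms. The remainder of
  length \<open>s < p\<close> contributes to each term an amount between 0 and
  \<open>p\<close>.\<close>

lemma mismatches_periodic_bound: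
  assumes "x \<in> periodic_configs p" "y \<in> periodic_configs p" "p > 0"
  shows "\<bar>mismatches x y a l - real l * (mismatches x y 0 p / p)\<bar> \<le> p"
proof -
  define c q s where "c = mismatches x y 0 p" and "q = l div p" and "s = l mod p"
  have l: "l = q * p + s" and s: "s < p"
    using assms(3) by (simp_all add: q_def s_def)
  have "mismatches x y a l = q * c + mismatches x y (a + int (q * p)) s"
    unfolding l mismatches_add mismatches_periodic_mult[OF assms(1,2)] c_def by simp
  moreover have "mismatches x y (a + int (q * p)) s \<le> p"
    using mismatches_le[of x y _ s] s by (meson le_trans less_imp_le)
  moreover have "real l * (c / p) = q * c + s * (c / p)"
    using assms(3) by (simp add: l field_simps)
  moreover have "s * (c / p) \<le> real p * 1"
    using s mismatches_le[of x y 0 p] assms(3)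
    by (intro mult_mono) (auto simp: c_def)
  moreover have "0 \<le> s * (c / p)" by simp
  ultimately show ?thesis
    unfolding c_def[symmetric] by linarith
qed

text \<open>A periodic configuration is recovered from its restriction to one period, and there are
  finitely many such restrictions because the alphabet is finite.\<close>

lemma finite_periodic_configs:
  assumes "p > 0"
  shows "finite (periodic_configs p :: ('a::finite) config set)"
proof (rule finite_subset)
  let ?A = "{0..<int p} \<rightarrow>\<^sub>E (UNIV :: 'a set)"
  show "periodic_configs p \<subseteq> (\<lambda>g i. g (i mod int p)) ` ?A"
  proof
    fix x :: "'a config" assume x: "x \<in> periodic_configs p"
    have shift: "x (i + k * int p) = x i" for i k
    proof -
      have "x (i + (k + 1) * int p) = x (i + k * int p)" for k
        using x[unfolded periodic_configs_def, simplified, rule_format, of "i + k * int p"]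
        by (simp add: algebra_simps)
      then have "x (i + k * int p) = x (i + 0 * int p)"
        by (rule int_successor_invariant_const)
      then show ?thesis by simp
    qed
    have "x i = restrict x {0..<int p} (i mod int p)" for i
      using shift[of "i mod int p" "i div int p"] assms by simp
    then have "x = (\<lambda>i. restrict x {0..<int p} (i mod int p))"
      by blast
    then show "x \<in> (\<lambda>g i. g (i mod int p)) ` ?A"
      by (rule image_eqI[where x = "restrict x {0..<int p}"]) auto
  qed
  show "finite ((\<lambda>g i. g (i mod int p)) ` ?A)"
    by (intro finite_imageI finite_PiE) auto
qed

lemma periodize_periodic: "periodize a p x \<in> periodic_configs p"
proof -
  have "(i + int p - a) mod int p = (i - a) mod int p" for i
    by (metis add_diff_eq add.commute mod_add_self2)
  then show ?thesis
    by (simp add: periodic_configs_def periodize_def)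
qed

lemma periodize_window: "a \<le> i \<Longrightarrow> i < a + int p \<Longrightarrow> periodize a p x i = x i"
  by (simp add: periodize_def)

section \<open>Comparing and computing the pseudometrics\<close>

lemma limsup_ereal_eqI:
  fixes s t :: "nat \<Rightarrow> real"
  assumes "\<And>n. \<bar>s n - t n\<bar> \<le> C / (2 * real n + 1)"
  shows "limsup (\<lambda>n. ereal (s n)) = limsup (\<lambda>n. ereal (t n))"
proof -
  have "(\<lambda>n. C / (2 * real n + 1)) \<longlonglongrightarrow> 0"
    by real_asymp
  then have "(\<lambda>n. s n - t n) \<longlonglongrightarrow> 0"
    by (rule Lim_null_comparison[rotated]) (use assms in auto)
  then have "(\<lambda>n. ereal (s n - t n)) \<longlonglongrightarrow> 0"
    by (simp add: zero_ereal_def)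
  \<comment> \<open>Limsup is additive when one summand converges to a finite limit.\<close>
  then have "limsup (\<lambda>n. ereal (s n - t n) + ereal (t n)) = 0 + limsup (\<lambda>n. ereal (t n))"
    by (rule ereal_limsup_lim_add) auto
  then show ?thesis by simp
qed

lemma max_window_density_attained: "\<exists>m. (MAX m. window_density x y m n) = window_density x y m n"
  using Max_in[OF finite_range_window_density[of x y n]] by auto

lemma window_density_le_max: "window_density x y m n \<le> (MAX m. window_density x y m n)"
  by (rule Max_ge[OF finite_range_window_density]) auto

text \<open>For the Weyl case it matters that \<open>C\<close> does not depend on \<open>m\<close>:
  testing each of the two densities at a maximizing position of the other carries the bound over to
  the maxima.\<close>

lemma dist_eqI:
  assumes dG: "d = besicovitch_dist \<or> d = weyl_dist"
    and close: "\<And>m n. \<bar>window_density x y m n - window_density x' y' m n\<bar> \<le> C / (2 * real n + 1)"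
  shows "d x y = d x' y'"
proof -
  have "\<bar>(MAX m. window_density x y m n) - (MAX m. window_density x' y' m n)\<bar> \<le> C / (2 * real n + 1)" for n
  proof -
    obtain m m' where m: "(MAX m. window_density x y m n) = window_density x y m n"
      "(MAX m. window_density x' y' m n) = window_density x' y' m' n"
      using max_window_density_attained by metis
    have "window_density x y m' n \<le> window_density x y m n"
      "window_density x' y' m n \<le> window_density x' y' m' n"
      using window_density_le_max m by metis+
    then show ?thesis
      unfolding m using close[of m n] close[of m' n] by linarith
  qed
  then have "weyl_dist x y = weyl_dist x' y'"
    unfolding weyl_dist_def by (rule limsup_ereal_eqI)
  moreover have "besicovitch_dist x y = besicovitch_dist x' y'"
    unfolding besicovitch_dist_def by (rule limsup_ereal_eqI) (rule close)
  ultimately show ?thesis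
    using dG by auto
qed

text \<open>Every window of length \<open>2 * n + 1\<close> has the density of one period up to
  \<open>p / (2 * n + 1)\<close>, wherever it lies, so both limsups are those of a constant.\<close>

lemma dist_periodic:
  assumes dG: "d = besicovitch_dist \<or> d = weyl_dist"
    and per: "x \<in> periodic_configs p" "y \<in> periodic_configs p" "p > 0"
  shows "d x y = ereal (mismatches x y 0 p / p)"
proof -
  let ?c = "mismatches x y 0 p / real p"
  have close: "\<bar>window_density x y m n - ?c\<bar> \<le> p / (2 * real n + 1)" for m n
  proof -
    have "window_density x y m n - ?c
        = (mismatches x y (m - int n) (2 * n + 1) - real (2 * n + 1) * ?c) / (2 * real n + 1)"
      unfolding window_density_mismatches diff_divide_distrib by (simp add: add.commute)
    then show ?thesis
      using mismatches_periodic_bound[OF per, of "m - int n" "2 * n + 1"]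
      by (simp add: abs_divide divide_right_mono)
  qed
  have "\<bar>(MAX m. window_density x y m n) - ?c\<bar> \<le> p / (2 * real n + 1)" for n
    using max_window_density_attained[of x y n] close by metis
  then have "limsup (\<lambda>n. ereal (MAX m. window_density x y m n)) = limsup (\<lambda>n. ereal ?c)"
    by (rule limsup_ereal_eqI)
  moreover have "limsup (\<lambda>n. ereal (window_density x y 0 n)) = limsup (\<lambda>n. ereal ?c)"
    by (rule limsup_ereal_eqI) (rule close)
  ultimately show ?thesis
    using dG by (auto simp: weyl_dist_def besicovitch_dist_def Limsup_const)
qed

section \<open>Locality of cellular automata\<close>

lemma cellular_automaton_translate:
  assumes "cellular_automaton f"
  shows "f (\<lambda>i. x (i + k)) = (\<lambda>i. f x (i + k))"
proof -
  have step: "f (\<lambda>i. z (i + 1)) = (\<lambda>i. f z (i + 1))" for z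
  proof -
    have "(f \<circ> shift) z = (shift \<circ> f) z"
      using assms by (simp add: cellular_automaton_def)
    then show ?thesis
      by (simp add: shift_def)
  qed
  \<comment> \<open>Translating by \<open>k\<close>, applying \<open>f\<close> and translating back
    gives a configuration that does not change with \<open>k\<close>; at \<open>k = 0\<close> it is
    \<open>f x\<close>.\<close>
  have "(\<lambda>j. f (\<lambda>i. x (i + (k + 1))) (j - (k + 1))) = (\<lambda>j. f (\<lambda>i. x (i + k)) (j - k))" for k
    using step[of "\<lambda>i. x (i + k)"] by (simp add: algebra_simps)
  then have "(\<lambda>j. f (\<lambda>i. x (i + k)) (j - k)) = (\<lambda>j. f (\<lambda>i. x (i + 0)) (j - 0))"
    by (rule int_successor_invariant_const)
  then have "f (\<lambda>i. x (i + k)) (i + k - k) = f (\<lambda>i. x (i + 0)) (i + k - 0)" for i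
    by (rule fun_cong)
  then show ?thesis by auto
qed

text \<open>This is one direction of the Curtis-Hedlund-Lyndon theorem. By compactness, finitely
  many cylinders on which the cell at 0 of the image is constant cover the space, so finitely many
  coordinates determine that cell; translation carries this to every cell.\<close>

lemma cellular_automaton_radius:
  fixes f :: "('a::finite) config \<Rightarrow> 'a config"
  assumes "cellular_automaton f"
  obtains r :: nat where
    "\<And>x y j. (\<And>i. \<bar>i - j\<bar> \<le> int r \<Longrightarrow> x i = y i) \<Longrightarrow> f x j = f y j"
proof -
  let ?T = "config_topology :: 'a config topology"
  have top: "topspace ?T = UNIV"
    by (simp add: config_topology_def)
  have comp: "compact_space ?T"
    unfolding config_topology_def
    by (simp add: compact_space_product_topology compact_space_discrete_topology)
  have "continuous_map ?T (discrete_topology UNIV) (\<lambda>x. f x 0)"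
    using assms unfolding cellular_automaton_def config_topology_def
    by (auto simp: continuous_map_componentwise_UNIV)
  then have opn: "openin ?T {x. f x 0 = b}" for b
    using openin_continuous_map_preimage[of ?T "discrete_topology UNIV" "\<lambda>x. f x 0" "{b}"] top by simp
  \<comment> \<open>\<open>U\<close> is a cylinder around \<open>w\<close>, and \<open>F\<close> is
    the set of coordinates that it constrains.\<close>
  have "\<exists>U F. w \<in> U \<and> openin ?T U \<and> finite F \<and>
      (\<forall>x\<in>U. f x 0 = f w 0) \<and> (\<forall>x\<in>U. \<forall>y. (\<forall>i\<in>F. x i = y i) \<longrightarrow> y \<in> U)" for w
  proof -
    obtain V where V: "finite {i. V i \<noteq> UNIV}" "w \<in> Pi\<^sub>E UNIV V" "Pi\<^sub>E UNIV V \<subseteq> {x. f x 0 = f w 0}"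
      using opn[of "f w 0"] unfolding config_topology_def openin_product_topology_alt
      by (force simp: PiE_UNIV_domain)
    have "openin ?T (Pi\<^sub>E UNIV V)"
      unfolding config_topology_def openin_PiE_gen using V(1) by auto
    moreover have "y \<in> Pi\<^sub>E UNIV V"
      if "x \<in> Pi\<^sub>E UNIV V" "\<forall>i\<in>{i. V i \<noteq> UNIV}. x i = y i" for x y
    proof -
      have "y i \<in> V i" for i
        using that unfolding PiE_UNIV_domain Pi_iff by (metis (mono_tags, lifting) UNIV_I mem_Collect_eq)
      then show ?thesis by (simp add: PiE_UNIV_domain)
    qed
    moreover have "\<forall>x\<in>Pi\<^sub>E UNIV V. f x 0 = f w 0"
      using V(3) by blast
    ultimately show ?thesis
      using V(1,2) by (intro exI[of _ "Pi\<^sub>E UNIV V"] exI[of _ "{i. V i \<noteq> UNIV}"] conjI) blast+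
  qed
  then obtain U F where U: "\<And>w. w \<in> U w" "\<And>w. openin ?T (U w)" "\<And>w. finite (F w)"
    "\<And>w x. x \<in> U w \<Longrightarrow> f x 0 = f w 0"
    "\<And>w x y. x \<in> U w \<Longrightarrow> (\<forall>i\<in>F w. x i = y i) \<Longrightarrow> y \<in> U w"
    by metis
  have "\<exists>\<F>. finite \<F> \<and> \<F> \<subseteq> range U \<and> topspace ?T \<subseteq> \<Union>\<F>"
    using comp U(1,2) unfolding compact_space_alt by (metis (no_types, lifting) UNIV_I UN_I imageE subsetI)
  then obtain W where W: "finite W" "(UNIV :: 'a config set) \<subseteq> \<Union>(U ` W)"
    unfolding top using finite_subset_image by metis
  \<comment> \<open>Inserting 0 keeps the maximum defined when the chosen cylinders constrain no
    coordinate.\<close>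
  define r where "r = Max (insert 0 ((\<lambda>i. nat \<bar>i\<bar>) ` (\<Union>w\<in>W. F w)))"
  have r: "\<bar>i\<bar> \<le> int r" if "w \<in> W" "i \<in> F w" for w i
  proof -
    have "nat \<bar>i\<bar> \<le> r"
      unfolding r_def by (rule Max_ge) (use that W(1) U(3) in auto)
    then show ?thesis by simp
  qed
  have zero: "f x 0 = f y 0" if "\<And>i. \<bar>i\<bar> \<le> int r \<Longrightarrow> x i = y i" for x y
  proof -
    obtain w where w: "w \<in> W" "x \<in> U w"
      using W(2) by blast
    then have "y \<in> U w"
      using U(5) r that by blast
    then show ?thesis
      using U(4) w(2) by metis
  qed
  show ?thesis
  proof (rule that)
    fix x y :: "'a config" and j
    assume "\<And>i. \<bar>i - j\<bar> \<le> int r \<Longrightarrow> x i = y i"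
    then have "f (\<lambda>i. x (i + j)) 0 = f (\<lambda>i. y (i + j)) 0"
      by (intro zero) simp
    then show "f x j = f y j"
      unfolding cellular_automaton_translate[OF assms] by simp
  qed
qed

lemma cellular_automaton_periodic:
  assumes "cellular_automaton f" "x \<in> periodic_configs p"
  shows "f x \<in> periodic_configs p"
proof -
  have "(\<lambda>i. x (i + int p)) = x"
    using assms(2) by (auto simp: periodic_configs_def)
  then have "(\<lambda>i. f x (i + int p)) = f x"
    using cellular_automaton_translate[OF assms(1), of x "int p"] by simp
  then show ?thesis
    by (auto simp: periodic_configs_def dest: fun_cong)
qed

section \<open>Rigidity on finite sets and its transfer to all configurations\<close>

lemma expanding_finite_isometry:
  fixes h :: "'b \<Rightarrow> 'b \<Rightarrow> nat"
  assumes fin: "finite P" and into: "f ` P \<subseteq> P"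
    and sep: "\<And>x y. x \<in> P \<Longrightarrow> y \<in> P \<Longrightarrow> h x y = 0 \<longleftrightarrow> x = y"
    and expand: "\<And>x y. x \<in> P \<Longrightarrow> y \<in> P \<Longrightarrow> h x y \<le> h (f x) (f y)"
    and xy: "x \<in> P" "y \<in> P"
  shows "h (f x) (f y) = h x y"
proof -
  \<comment> \<open>If \<open>f x = f y\<close>, then \<open>h (f x) (f y) = 0\<close> by
    \<open>sep\<close>, which forces \<open>h x y = 0\<close> by expansion.\<close>
  have "inj_on f P"
    by (rule inj_onI) (metis expand sep into image_subset_iff le_zero_eq)
  then have bij: "bij_betw f P P"
    using endo_inj_surj[OF fin into] by (simp add: bij_betw_def)
  have "(\<Sum>(x, y)\<in>P \<times> P. h (f x) (f y)) = (\<Sum>(x, y)\<in>P \<times> P. h x y)"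
    using sum.reindex_bij_betw[OF bij_betw_map_prod[OF bij bij], of "case_prod h"]
    by (simp add: case_prod_unfold)
  then have "(\<Sum>z\<in>P \<times> P. h (fst z) (snd z)) = (\<Sum>z\<in>P \<times> P. h (f (fst z)) (f (snd z)))"
    by (simp add: case_prod_unfold)
  \<comment> \<open>Equal finite sums whose terms are ordered one by one have equal terms.\<close>
  from sum_mono_inv[OF this, of "(x, y)"] show ?thesis
    using expand fin xy by force
qed

lemma mismatches_eq_0_iff:
  assumes "x \<in> periodic_configs p" "y \<in> periodic_configs p" "p > 0"
  shows "mismatches x y 0 p = 0 \<longleftrightarrow> x = y"
proof
  assume "mismatches x y 0 p = 0"
  \<comment> \<open>Sliding the window to start at \<open>i\<close> makes cell \<open>i\<close> its
    first cell, which exists because \<open>p > 0\<close>.\<close>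
  then have "mismatches x y i p = 0" for i
    using mismatches_periodic_shift[OF assms(1,2)] by metis
  then have "x i = y i" for i
    using assms(3) by (force simp: mismatches_def dest: spec[of _ 0])
  then show "x = y" by blast
qed (simp add: mismatches_def)

text \<open>Only the margins of \<open>r\<close> cells at the two ends can contribute. Truncated
  subtraction covers short windows: if \<open>p \<le> 2 * r\<close>, the margins fill the whole
  window and the premise is vacuous.\<close>

lemma mismatches_diff_le:
  assumes "\<And>k. k < p \<Longrightarrow> r \<le> k \<Longrightarrow> k < p - r \<Longrightarrow> x (a + int k) = x' (a + int k) \<and> y (a + int k) = y' (a + int k)"
  shows "\<bar>real (mismatches x y a p) - real (mismatches x' y' a p)\<bar> \<le> 2 * real r"
proof -
  let ?B = "{..<p} \<inter> {k. k < r \<or> p - r \<le> k}"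
  have "\<bar>real (mismatches x y a p) - real (mismatches x' y' a p)\<bar>
      \<le> (\<Sum>k<p. \<bar>of_bool (x (a + int k) \<noteq> y (a + int k)) - of_bool (x' (a + int k) \<noteq> y' (a + int k))\<bar>)"
    unfolding mismatches_def of_nat_sum of_nat_of_bool sum_subtractf[symmetric] by (rule sum_abs)
  also have "\<dots> \<le> (\<Sum>k<p. of_bool (k < r \<or> p - r \<le> k))"
    by (rule sum_mono) (use assms in \<open>auto simp: of_bool_def not_less not_le\<close>)
  also have "\<dots> = real (card ?B)"
    by (simp add: of_bool_def sum.If_cases)
  also have "card ?B \<le> card ({..<r} \<union> {p - r..<p})"
    by (rule card_mono) auto
  also have "\<dots> \<le> card {..<r} + card {p - r..<p}"
    by (rule card_Un_le)
  also have "\<dots> \<le> 2 * r" by simp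
  finally show ?thesis by simp
qed

theorem corollary4:
  fixes d\<^sub>G :: "('a::finite) config \<Rightarrow> 'a config \<Rightarrow> ereal"
    and f :: "'a config \<Rightarrow> 'a config"
  assumes "d\<^sub>G = besicovitch_dist \<or> d\<^sub>G = weyl_dist"
    and "cellular_automaton f"
    and "\<forall>x y. d\<^sub>G x y \<le> d\<^sub>G (f x) (f y)"
  shows "\<forall>x y. d\<^sub>G x y = d\<^sub>G (f x) (f y)"
proof (intro allI)
  fix x y :: "'a config"
  obtain r :: nat where r: "\<And>x y j. (\<And>i. \<bar>i - j\<bar> \<le> int r \<Longrightarrow> x i = y i) \<Longrightarrow> f x j = f y j"
    using cellular_automaton_radius[OF assms(2)] by blast
  have isom: "mismatches (f u) (f v) a p = mismatches u v a p"
    if uv: "u \<in> periodic_configs p" "v \<in> periodic_configs p" and p: "p > 0" for u v a p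
  proof -
    have "mismatches u v 0 p \<le> mismatches (f u) (f v) 0 p"
      if "u \<in> periodic_configs p" "v \<in> periodic_configs p" for u v
    proof -
      \<comment> \<open>The images are periodic with the same \<open>p\<close>, so the common
        denominator cancels and the expansion of distances becomes one of integer counts.\<close>
      have "ereal (mismatches u v 0 p / p) \<le> ereal (mismatches (f u) (f v) 0 p / p)"
        using assms(3) dist_periodic[OF assms(1) _ _ p] that cellular_automaton_periodic[OF assms(2)]
        by metis
      then show ?thesis
        using p by (simp add: divide_le_cancel)
    qed
    then have "mismatches (f u) (f v) 0 p = mismatches u v 0 p"
      using cellular_automaton_periodic[OF assms(2)] uv
      by (intro expanding_finite_isometry[OF finite_periodic_configs[OF p]])
        (auto simp: mismatches_eq_0_iff p)
    then show ?thesis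
      using mismatches_periodic_shift uv cellular_automaton_periodic[OF assms(2)] by metis
  qed
  show "d\<^sub>G x y = d\<^sub>G (f x) (f y)"
  proof (rule dist_eqI[OF assms(1)])
    fix m n
    define a p where "a = m - int n" and "p = 2 * n + 1"
    let ?x = "periodize a p x" and ?y = "periodize a p y"
    \<comment> \<open>For such \<open>k\<close> all cells within distance \<open>r\<close> of
      \<open>a + k\<close> lie in the window, where the periodic continuation agrees with
      \<open>z\<close>.\<close>
    have same: "f (periodize a p z) (a + int k) = f z (a + int k)" if "r \<le> k" "k < p - r" for z k
      by (rule r, rule periodize_window) (use that in auto)
    \<comment> \<open>Periodizing the arguments costs nothing inside the window; the error
      \<open>2 * r\<close> arises only when \<open>f ?x\<close> and \<open>f ?y\<close> are replaced
      by \<open>f x\<close> and \<open>f y\<close>.\<close>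
    have "mismatches x y a p = mismatches ?x ?y a p"
      by (simp add: mismatches_def periodize_window)
    also have "\<dots> = mismatches (f ?x) (f ?y) a p"
      by (simp add: isom periodize_periodic p_def)
    finally have "\<bar>real (mismatches x y a p) - real (mismatches (f x) (f y) a p)\<bar> \<le> 2 * real r"
      using mismatches_diff_le[of p r "f ?x" a "f x" "f ?y" "f y"] same by simp
    then show "\<bar>window_density x y m n - window_density (f x) (f y) m n\<bar> \<le> 2 * real r / (2 * real n + 1)"
      unfolding window_density_mismatches a_def p_def
      by (simp add: divide_right_mono flip: diff_divide_distrib)
  qed
qed

end
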